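(* The floor quotient relation $\preccurlyeq_1$ defines a partial order $\mathcal{Q} = (\mathbb{N}^+, \preccurlyeq_1)$ on the positive integers. Moreover, $\mathcal{Q}$ is an approximate divisor order.
   Context: $\mathbb{N}^+ = \{1,2,3,\ldots\}$. For positive integers $d,n$, $d$ is a floor quotient of $n$, written $d \preccurlyeq_1 n$, if $d = \lfloor n/k \rfloor$ for some positive integer $k$. A partial order $\mathcal{P} = (\mathbb{N}^+, \preccurlyeq)$ on the positive integers is called an approximate divisor order if for all $d,n \in \mathbb{N}^+$: (1) $d \mid n$ implies $d \preccurlyeq n$; and (2) $d \preccurlyeq n$ implies $d \le n$ (usual order on integers). *)

theory Defs
  imports Complex_Main
begin

abbreviation pos_nats :: "nat set" where
  "pos_nats \<equiv> {1..}"

definition floor_quotient :: "nat \<Rightarrow> nat \<Rightarrow> bool" where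
  "floor_quotient d n \<longleftrightarrow> (\<exists>k\<in>pos_nats. int d = \<lfloor>real n / real k\<rfloor>)"

text \<open>
  The notion is meant for positive d and n only (as a predicate on all naturals,
  0 would be a floor quotient of every n), so the relation is restricted to the
  positive integers here.
\<close>

definition floor_quotient_rel :: "nat rel" where
  "floor_quotient_rel = {(d, n). d \<in> pos_nats \<and> n \<in> pos_nats \<and> floor_quotient d n}"

definition approximate_divisor_order :: "nat rel \<Rightarrow> bool" where
  "approximate_divisor_order r \<longleftrightarrow>
     partial_order_on pos_nats r \<and>
     (\<forall>d\<in>pos_nats. \<forall>n\<in>pos_nats. (d dvd n \<longrightarrow> (d, n) \<in> r) \<and> ((d, n) \<in> r \<longrightarrow> d \<le> n))"

end

theory Submission
  imports Defs
begin

text \<open>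
  On natural numbers the floor of \<open>n / k\<close> is the truncated quotient \<open>n div k\<close>, so \<open>d\<close> is a
  floor quotient of \<open>n\<close> exactly when \<open>d = n div k\<close> for some \<open>k \<ge> 1\<close>. Each property of the
  relation then reflects one fact about \<open>div\<close>: \<open>n div (k * l) = n div k div l\<close> gives
  transitivity, since the denominators of two successive floor quotients multiply, and
  \<open>n div k \<le> n\<close> shows that the relation refines the usual order, from which it inherits
  antisymmetry. Divisors occur among the floor quotients because, for \<open>d dvd n\<close>, dividing
  by the complementary divisor \<open>n div d\<close> leaves no remainder; the case \<open>d = n\<close>, with
  denominator 1, is reflexivity.
\<close>

lemma floor_quotient_iff_div: "floor_quotient d n \<longleftrightarrow> (\<exists>k\<ge>1. d = n div k)"
  by (auto simp: floor_quotient_def floor_divide_of_nat_eq)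

lemma floor_quotient_le: "floor_quotient d n \<Longrightarrow> d \<le> n"
  by (auto simp: floor_quotient_iff_div)

lemma floor_quotient_trans:
  assumes "floor_quotient d m" and "floor_quotient m n"
  shows "floor_quotient d n"
proof -
  obtain k l where "k \<ge> 1" "m = n div k" "l \<ge> 1" "d = m div l"
    using assms by (auto simp: floor_quotient_iff_div)
  then have "k * l \<ge> 1" "d = n div (k * l)"
    by (simp_all add: div_mult2_eq)
  then show ?thesis
    unfolding floor_quotient_iff_div by blast
qed

text \<open>
  Positivity of \<open>n\<close> ensures that the complementary divisor \<open>n div d\<close> is at least 1, hence an
  admissible denominator.
\<close>

lemma dvd_imp_floor_quotient:
  assumes "d dvd n" and "n \<ge> 1"
  shows "floor_quotient d n"
proof -
  obtain c where "n = d * c"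
    using \<open>d dvd n\<close> by (elim dvdE)
  with \<open>n \<ge> 1\<close> have "c \<ge> 1" "d = n div c"
    by auto
  then show ?thesis
    unfolding floor_quotient_iff_div by blast
qed

lemma partial_order_on_floor_quotient_rel: "partial_order_on pos_nats floor_quotient_rel"
  unfolding partial_order_on_def preorder_on_def
proof (intro conjI)
  show "refl_on pos_nats floor_quotient_rel"
    by (auto simp: refl_on_def floor_quotient_rel_def dvd_imp_floor_quotient)
  show "trans floor_quotient_rel"
    by (auto simp: trans_def floor_quotient_rel_def intro: floor_quotient_trans)
  show "antisym floor_quotient_rel"
    by (auto simp: antisym_def floor_quotient_rel_def intro: order_antisym floor_quotient_le)
qed (auto simp: floor_quotient_rel_def)

theorem theorem1p2:
  shows "partial_order_on pos_nats floor_quotient_rel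
    \<and> approximate_divisor_order floor_quotient_rel"
  using partial_order_on_floor_quotient_rel
  by (auto simp: approximate_divisor_order_def floor_quotient_rel_def
      intro: dvd_imp_floor_quotient floor_quotient_le)

end
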